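(* Let $s$ be an even positive integer. There exists a positive integer $n$ such that for every positive integer $t$ there is a graph $G$ of order $snt$ with $$\lambda_{1}^{\ast}(G)+\cdots+\lambda_{s^{2}}^{\ast}(G)=\frac{1}{2}(1+s)snt.$$
   Context: Graphs are finite, simple and undirected; the order of a graph is its number of vertices. For a graph $G$, $\lambda_i^{\ast}(G)$ denotes the $i$'th largest singular value of its adjacency matrix, i.e. the $i$'th largest of the absolute values of its adjacency eigenvalues (with multiplicity). *)

theory Defs
  imports
    "Graph_Theory.Pair_Digraph"
    "Jordan_Normal_Form.Spectral_Radius"
begin

text \<open>
  Finite simple undirected graphs are the library's pair_graph: finite, loop-free, with a symmetric
  set of arcs. The vertices index the matrix in increasing order; another enumeration conjugates
  the matrix by a permutation and does not change its spectrum.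
\<close>

definition adjacency_mat :: "'a :: linorder pair_pre_digraph \<Rightarrow> real mat" where
  "adjacency_mat G =
    (let vs = sorted_list_of_set (pverts G)
     in mat (length vs) (length vs) (\<lambda>(i, j). if (vs ! i, vs ! j) \<in> parcs G then 1 else 0))"

text \<open>
  The singular values of a real square matrix, with multiplicity, are the square roots of the
  eigenvalues of its Gram matrix. That matrix is symmetric and positive semidefinite, so the real
  roots of its characteristic polynomial are all of its eigenvalues. For symmetric matrices, such as
  adjacency matrices, singular_values_symmetric below shows that they are the absolute values
  of the eigenvalues, as many as the order of the matrix.
\<close>

definition singular_values :: "real mat \<Rightarrow> real multiset" where
  "singular_values A = image_mset sqrt (proots (char_poly (transpose_mat A * A)))"

text \<open>
  Indices start at 1. The value is 0 where there is no i'th singular value, i.e. for i larger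
  than the order of the graph.
\<close>

definition lambda_star :: "'a :: linorder pair_pre_digraph \<Rightarrow> nat \<Rightarrow> real" where
  "lambda_star G i =
    (let xs = rev (sorted_list_of_multiset (singular_values (adjacency_mat G)))
     in if 1 \<le> i \<and> i \<le> length xs then xs ! (i - 1) else 0)"

lemma symmetric_char_poly_splits:
  fixes A :: "real mat"
  assumes A: "A \<in> carrier_mat n n" and sym: "transpose_mat A = A"
  shows "\<exists>es. char_poly A = (\<Prod>e\<leftarrow>es. [:- e, 1:]) \<and> length es = n"
proof -
  let ?C = "map_mat complex_of_real A"
  have C: "?C \<in> carrier_mat n n" using A by simp
  obtain cs where cs: "char_poly ?C = (\<Prod>c\<leftarrow>cs. [:- c, 1:])" "length cs = n"
    using char_poly_factorized[OF C] by blast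
  have real: "c = complex_of_real (Re c)" if "c \<in> set cs" for c
  proof -
    have "poly (char_poly ?C) c = 0"
      unfolding cs(1) using that by (auto simp: poly_prod_list prod_list_zero_iff)
    then have "eigenvalue ?C c" using eigenvalue_root_char_poly[OF C] by blast
    then obtain v where v: "v \<in> carrier_vec n" "v \<noteq> 0\<^sub>v n" "?C *\<^sub>v v = c \<cdot>\<^sub>v v"
      unfolding eigenvalue_def eigenvector_def using A by auto
    have T: "transpose_mat ?C = ?C" using sym by (metis map_mat_transpose)
    have conjC: "?C *\<^sub>v conjugate v = conjugate (?C *\<^sub>v v)"
      using A v(1) by (intro eq_vecI) (auto simp: scalar_prod_def)
    have "c * (v \<bullet>c v) = (?C *\<^sub>v v) \<bullet> conjugate v"
      using v by simp
    also have "\<dots> = v \<bullet> (transpose_mat ?C *\<^sub>v conjugate v)"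
    proof -
      have *: "(transpose_mat ?C *\<^sub>v w) \<bullet> u = w \<bullet> (?C *\<^sub>v u)"
        if "w \<in> carrier_vec n" "u \<in> carrier_vec n" for w u :: "complex vec"
        using transpose_vec_mult_scalar[OF C that(2) that(1)] .
      show ?thesis using *[of v "conjugate v"] v(1) unfolding T by simp
    qed
    also have "transpose_mat ?C = ?C" by (rule T)
    also have "v \<bullet> (?C *\<^sub>v conjugate v) = v \<bullet> (cnj c \<cdot>\<^sub>v conjugate v)"
      unfolding conjC v(3) by (simp add: conjugate_smult_vec)
    also have "\<dots> = cnj c * (v \<bullet>c v)" using v(1) by simp
    finally have "c = cnj c" using v(1,2) by (simp add: conjugate_square_eq_0_vec)
    then show ?thesis by (metis Reals_cnj_iff of_real_Re)
  qed
  interpret of_real_poly_hom: map_poly_inj_idom_hom complex_of_real ..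
  have "map_poly complex_of_real (char_poly A) = char_poly ?C"
    by (rule of_real_hom.char_poly_hom[OF A, symmetric])
  also have "\<dots> = (\<Prod>r\<leftarrow>map Re cs. map_poly complex_of_real [:- r, 1:])"
    unfolding cs(1) map_map o_def using real
    by (intro arg_cong[where f = prod_list] map_cong) (auto simp: map_poly_pCons)
  also have "\<dots> = map_poly complex_of_real (\<Prod>r\<leftarrow>map Re cs. [:- r, 1:])"
    by (simp add: of_real_poly_hom.hom_prod_list o_def)
  finally have "char_poly A = (\<Prod>r\<leftarrow>map Re cs. [:- r, 1:])"
    by simp
  then show ?thesis using cs(2) by (metis length_map)
qed

lemma proots_linear_factors:
  "proots (\<Prod>e\<leftarrow>es. [:- e, 1:]) = mset (es :: real list)"
proof (induction es)
  case (Cons e es)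
  have "(\<Prod>e\<leftarrow>es. [:- e, 1:]) \<noteq> (0 :: real poly)"
    by (auto simp: prod_list_zero_iff)
  then show ?case
    using Cons by (simp add: proots_mult del: mult_pCons_left)
qed simp

lemma singular_values_symmetric:
  assumes A: "A \<in> carrier_mat n n" and sym: "transpose_mat A = A"
  shows "singular_values A = image_mset abs (proots (char_poly A))"
    and "size (singular_values A) = n"
proof -
  obtain es where es: "char_poly A = (\<Prod>e\<leftarrow>es. [:- e, 1:])" "length es = n"
    using symmetric_char_poly_splits[OF assms] by blast
  obtain B P Q where "schur_decomposition A es = (B, P, Q)"
    by (cases "schur_decomposition A es") auto
  from schur_decomposition[OF A es(1) this]
  have w: "similar_mat_wit A B P Q" and ut: "upper_triangular B" and diag: "diag_mat B = es"
    by auto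
  have B: "B \<in> carrier_mat n n" using similar_mat_witD2[OF A w] by blast
  have "similar_mat (A ^\<^sub>m 2) (B ^\<^sub>m 2)"
    using similar_mat_wit_pow[OF w, of 2] unfolding similar_mat_def by blast
  then have sim: "char_poly (A * A) = char_poly (B * B)"
    using char_poly_similar A B by (fastforce simp: numeral_2_eq_2)
  have entry: "(B * B) $$ (i, j) = (\<Sum>k<n. B $$ (i, k) * B $$ (k, j))" if "i < n" "j < n" for i j
    using that B by (auto simp: scalar_prod_def lessThan_atLeast0)
  have low: "B $$ (i, j) = 0" if "j < i" "i < n" for i j
    using ut B that by auto
  have "upper_triangular (B * B)"
  proof (intro upper_triangularI)
    fix i j assume ij: "j < i" "i < dim_row (B * B)"
    have "B $$ (i, k) * B $$ (k, j) = 0" if "k < n" for k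
      using that ij B low[of k i] low[of j k] by (cases "k < i") auto
    then have "(\<Sum>k<n. B $$ (i, k) * B $$ (k, j)) = 0"
      by (intro sum.neutral) auto
    then show "(B * B) $$ (i, j) = 0" using ij B entry[of i j] by simp
  qed
  moreover have "diag_mat (B * B) = map (\<lambda>e. e\<^sup>2) es"
  proof -
    have "(B * B) $$ (i, i) = (B $$ (i, i))\<^sup>2" if i: "i < n" for i
    proof -
      have "B $$ (i, k) * B $$ (k, i) = 0" if "k < n" "k \<noteq> i" for k
        using that i low[of k i] low[of i k] by (cases "k < i") auto
      then have "(\<Sum>k<n. B $$ (i, k) * B $$ (k, i)) = (\<Sum>k\<in>{i}. B $$ (i, k) * B $$ (k, i))"
        using i by (intro sum.mono_neutral_right) auto
      then show ?thesis using entry[OF i i] by (simp add: power2_eq_square)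
    qed
    then show ?thesis using B unfolding diag[symmetric] diag_mat_def by auto
  qed
  ultimately have "char_poly (A * A) = (\<Prod>e\<leftarrow>map (\<lambda>e. e\<^sup>2) es. [:- e, 1:])"
    using char_poly_upper_triangular[of "B * B" n] B sim by simp
  then have roots: "proots (char_poly (A * A)) = mset (map (\<lambda>e. e\<^sup>2) es)"
    by (simp only: proots_linear_factors)
  then show "singular_values A = image_mset abs (proots (char_poly A))"
    unfolding singular_values_def sym es(1) proots_linear_factors
    by (simp add: multiset.map_comp o_def)
  show "size (singular_values A) = n"
    unfolding singular_values_def sym roots using es(2) by simp
qed

end

theory Submission
  imports Defs
begin

text \<open>
  Write \<open>N = snt\<close>, \<open>c = nt\<close> and let \<open>J\<close> be the all-ones matrix. The adjacency matrix of the graph is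
  \<open>A = (J + H) / 2\<close> for a symmetric sign matrix \<open>H\<close> of order \<open>N = sc\<close> with diagonal \<open>- 1\<close>, \<open>H 1 = c 1\<close>
  and \<open>H\<^sup>3 = c\<^sup>2 H\<close>. The last condition says that the nonzero eigenvalues of \<open>H\<close> are \<open>\<plusminus>c\<close>, and
  \<open>tr H\<^sup>2 = N\<^sup>2\<close> forces exactly \<open>s\<^sup>2\<close> of them. Adding \<open>J\<close> only changes the eigenvalue of the all-ones
  vector, from \<open>c\<close> to \<open>N + c\<close>. So the singular values of \<open>A\<close> are \<open>(s + 1) c / 2\<close> once, \<open>c / 2\<close> with
  multiplicity \<open>s\<^sup>2 - 1\<close>, and zeros, and the largest \<open>s\<^sup>2\<close> of them add up to
  \<open>(s + 1) c / 2 + (s\<^sup>2 - 1) c / 2 = s (s + 1) c / 2\<close>. This is \<open>sign_matrix_singular_values\<close>; there the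
  multiplicities are found from the traces of \<open>A\<^sup>2\<close> and \<open>A\<^sup>4\<close>, so no eigenvectors are constructed.

  To build \<open>H\<close>, take an \<open>s \<times> n\<close> sign matrix \<open>X\<close> with orthogonal rows, \<open>n = 2\<^sup>s\<close>. On the positions
  \<open>(r, a)\<close> of \<open>X\<close>, the symmetric matrix \<open>M\<close> with entries \<open>X(r, b) X(r', a)\<close> at \<open>((r, a), (r', b))\<close> acts on
  \<open>s \<times> n\<close> matrices by \<open>Z \<mapsto> X Z\<^sup>T X\<close>; up to the order of its columns it is the Kronecker product of
  \<open>X\<close> and its transpose, so its singular values are \<open>n\<close>, with multiplicity \<open>s\<^sup>2\<close>, and zeros. Its
  diagonal is \<open>1\<close>, so its sign must be reversed, and the all-ones vector must still have a positive
  eigenvalue. Both are achieved by a sign matrix \<open>Y\<close> with \<open>M Y = - n Y\<close>: conjugating \<open>- M\<close> by the diagonal matrix of the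
  entries of \<open>Y\<close> then moves \<open>Y\<close> to the all-ones vector. For \<open>Y = Q X\<close> with \<open>Q\<close> of order \<open>s\<close> the condition
  becomes \<open>Q\<^sup>T X = - Q X\<close>, and a skew-symmetric signed permutation matrix \<open>Q\<close> does it. Such a \<open>Q\<close> exists
  because \<open>s\<close> is even: swap the rows of \<open>X\<close> in pairs and negate one row of each pair. Replacing every
  entry by a constant \<open>t \<times> t\<close> block finally gives \<open>H\<close> (\<open>sign_matrix_exists\<close>).
\<close>

section \<open>Spectra of symmetric matrices and traces\<close>

lemma trace_mult_commute:
  fixes A B :: "'a :: comm_semiring_0 mat"
  assumes "A \<in> carrier_mat n m" "B \<in> carrier_mat m n"
  shows "(\<Sum>i<n. (A * B) $$ (i, i)) = (\<Sum>j<m. (B * A) $$ (j, j))"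
proof -
  have "(\<Sum>i<n. (A * B) $$ (i, i)) = (\<Sum>i<n. \<Sum>j<m. A $$ (i, j) * B $$ (j, i))"
    using assms by (auto simp: scalar_prod_def lessThan_atLeast0 intro!: sum.cong)
  also have "\<dots> = (\<Sum>j<m. \<Sum>i<n. B $$ (j, i) * A $$ (i, j))"
    by (subst sum.swap) (simp add: mult.commute)
  also have "\<dots> = (\<Sum>j<m. (B * A) $$ (j, j))"
    using assms by (auto simp: scalar_prod_def lessThan_atLeast0 intro!: sum.cong)
  finally show ?thesis .
qed

lemma trace_eq_sum_roots:
  fixes A :: "real mat"
  assumes A: "A \<in> carrier_mat n n" and es: "char_poly A = (\<Prod>e\<leftarrow>es. [:- e, 1:])"
  shows "(\<Sum>i<n. A $$ (i, i)) = sum_list es"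
proof -
  obtain B P Q where "schur_decomposition A es = (B, P, Q)"
    by (cases "schur_decomposition A es") auto
  from schur_decomposition[OF A es this]
  have w: "similar_mat_wit A B P Q" and diag: "diag_mat B = es"
    by auto
  note W = similar_mat_witD2[OF A w]
  have "A = P * (B * Q)"
    using W(3) assoc_mult_mat[OF W(6,5,7)] by simp
  then have "(\<Sum>i<n. A $$ (i, i)) = (\<Sum>i<n. (B * Q * P) $$ (i, i))"
    using trace_mult_commute[of P n n "B * Q"] W(5-7) by simp
  also have "B * Q * P = B"
    using assoc_mult_mat[OF W(5,7,6)] W(2,5) by simp
  also have "(\<Sum>i<n. B $$ (i, i)) = sum_list es"
    using W(5) unfolding diag[symmetric] diag_mat_def
    by (auto simp: sum_list_sum_nth lessThan_atLeast0)
  finally show ?thesis .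
qed

text \<open>
  The three handles on the spectrum of a symmetric matrix: the first two moments, which determine
  multiplicities once the possible eigenvalues are known, and eigenvectors, which restrict the
  possible eigenvalues. Eigenvectors are plain functions so that the arguments about them are
  computations with sums.
\<close>

lemma symmetric_spectrum:
  fixes A :: "real mat"
  assumes A: "A \<in> carrier_mat n n" and sym: "transpose_mat A = A"
  obtains es where "proots (char_poly A) = mset es" "length es = n"
    "sum_list es = (\<Sum>i<n. A $$ (i, i))"
    "(\<Sum>e\<leftarrow>es. e\<^sup>2) = (\<Sum>i<n. \<Sum>j<n. (A $$ (i, j))\<^sup>2)"
    "\<forall>e\<in>set es.
      \<exists>v. (\<exists>i<n. v i \<noteq> 0) \<and> (\<forall>i<n. (\<Sum>j<n. A $$ (i, j) * v j) = e * v i)"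
proof -
  obtain es where es: "char_poly A = (\<Prod>e\<leftarrow>es. [:- e, 1:])" "length es = n"
    using symmetric_char_poly_splits[OF assms] by blast
  have AA: "A * A \<in> carrier_mat n n" and symAA: "transpose_mat (A * A) = A * A"
    using A sym by (auto simp: transpose_mult[OF A A])
  obtain fs where fs: "char_poly (A * A) = (\<Prod>e\<leftarrow>fs. [:- e, 1:])"
    using symmetric_char_poly_splits[OF AA symAA] by blast
  have "image_mset sqrt (mset fs) = image_mset abs (mset es)"
    using singular_values_symmetric(1)[OF assms]
    unfolding singular_values_def sym fs es(1) proots_linear_factors .
  then have "image_mset (\<lambda>x. x * \<bar>x\<bar>) (image_mset sqrt (mset fs))
    = image_mset (\<lambda>x. x * \<bar>x\<bar>) (image_mset abs (mset es))" by simp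
  \<comment> \<open>The function \<open>sqrt\<close> is odd and so injective on all reals; undoing it on both sides turns
    the equality of singular values into one of eigenvalues of \<open>A\<^sup>2\<close>.\<close>
  moreover have "sqrt x * \<bar>sqrt x\<bar> = x" for x :: real
    using real_sqrt_minus[of "- x"] by (cases "x \<ge> 0") auto
  ultimately have "mset fs = mset (map (\<lambda>e. e\<^sup>2) es)"
    by (simp add: multiset.map_comp o_def power2_eq_square)
  then have "(\<Sum>e\<leftarrow>es. e\<^sup>2) = sum_list fs"
    by (metis sum_mset_sum_list)
  also have "\<dots> = (\<Sum>i<n. (A * A) $$ (i, i))"
    using trace_eq_sum_roots[OF AA fs] by simp
  also have "\<dots> = (\<Sum>i<n. \<Sum>j<n. (A $$ (i, j))\<^sup>2)"
  proof -
    have "A $$ (j, i) = A $$ (i, j)" if "i < n" "j < n" for i j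
      using A that sym by (metis carrier_matD index_transpose_mat(1))
    then show ?thesis
      using A by (auto simp: scalar_prod_def lessThan_atLeast0 power2_eq_square intro!: sum.cong)
  qed
  finally have sq: "(\<Sum>e\<leftarrow>es. e\<^sup>2) = (\<Sum>i<n. \<Sum>j<n. (A $$ (i, j))\<^sup>2)" .
  have ev: "\<exists>v. (\<exists>i<n. v i \<noteq> 0) \<and> (\<forall>i<n. (\<Sum>j<n. A $$ (i, j) * v j) = e * v i)"
    if "e \<in> set es" for e
  proof -
    have "poly (char_poly A) e = 0"
      unfolding es(1) using that by (auto simp: poly_prod_list prod_list_zero_iff)
    then have "eigenvalue A e" using eigenvalue_root_char_poly[OF A] by blast
    then obtain v where v: "v \<in> carrier_vec n" "v \<noteq> 0\<^sub>v n" "A *\<^sub>v v = e \<cdot>\<^sub>v v"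
      unfolding eigenvalue_def eigenvector_def using A by auto
    have "\<exists>i<n. v $ i \<noteq> 0"
      using v(1,2) by (metis carrier_vecD eq_vecI index_zero_vec)
    moreover have "(\<Sum>j<n. A $$ (i, j) * v $ j) = e * v $ i" if "i < n" for i
    proof -
      have "(A *\<^sub>v v) $ i = (\<Sum>j<n. A $$ (i, j) * v $ j)"
        using A v(1) that by (auto simp: scalar_prod_def lessThan_atLeast0 intro!: sum.cong)
      then show ?thesis using v that by simp
    qed
    ultimately show ?thesis by (intro exI[of _ "\<lambda>i. v $ i"]) auto
  qed
  show thesis
    using that[of es] es(2) sq ev trace_eq_sum_roots[OF A es(1)]
    by (simp add: es(1) proots_linear_factors)
qed

section \<open>Singular values of the graph of a sign matrix\<close>

lemma mset_three_values:
  assumes "set_mset S \<subseteq> {x, y, z}" "x \<noteq> y" "x \<noteq> z" "y \<noteq> z"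
  shows "S = replicate_mset (count S x) x + replicate_mset (count S y) y
    + replicate_mset (count S z) z"
proof (rule multiset_eqI)
  fix a
  show "count S a = count (replicate_mset (count S x) x + replicate_mset (count S y) y
    + replicate_mset (count S z) z) a"
  proof (cases "a \<in># S")
    case True
    then have "a = x \<or> a = y \<or> a = z" using assms(1) by blast
    then show ?thesis using assms(2-4) by (elim disjE) simp_all
  next
    case False
    then show ?thesis by (auto simp: not_in_iff)
  qed
qed

text \<open>
  Let \<open>B = A\<^sup>2\<close> be the Gram matrix and \<open>g\<close> the entries of \<open>H\<^sup>2\<close>, so that \<open>4 B = (N + 2c) J + H\<^sup>2\<close>. An
  eigenvector of \<open>B\<close> whose entries do not add up to \<open>0\<close> must belong to the eigenvalue of the all-ones
  vector, because \<open>J B\<close> is a multiple of \<open>J\<close>. On the other eigenvectors \<open>J\<close> vanishes, and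
  \<open>H\<^sup>4 = c\<^sup>2 H\<^sup>2\<close> leaves only \<open>0\<close> and \<open>(c / 2)\<^sup>2\<close>. The two nonzero candidates are distinct, so the traces of
  \<open>B\<close> and \<open>B\<^sup>2\<close> form a regular linear system for their multiplicities.
\<close>

lemma sign_matrix_singular_values:
  fixes h :: "nat \<Rightarrow> nat \<Rightarrow> real" and c :: real and s N :: nat
  assumes c: "c > 0" and s: "s > 0" and N: "real N = s * c"
    and sym: "\<And>i j. i < N \<Longrightarrow> j < N \<Longrightarrow> h i j = h j i"
    and sign: "\<And>i j. i < N \<Longrightarrow> j < N \<Longrightarrow> (h i j)\<^sup>2 = 1"
    and row: "\<And>i. i < N \<Longrightarrow> (\<Sum>j<N. h i j) = c"
    and cube: "\<And>i j. i < N \<Longrightarrow> j < N \<Longrightarrow>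
      (\<Sum>k<N. (\<Sum>l<N. h i l * h l k) * h k j) = c\<^sup>2 * h i j"
  shows "singular_values (mat N N (\<lambda>(i, j). (1 + h i j) / 2)) =
    add_mset ((1 + s) * c / 2) (replicate_mset (s\<^sup>2 - 1) (c / 2) + replicate_mset (N - s\<^sup>2) 0)"
proof -
  define g where "g i j = (\<Sum>k<N. h i k * h k j)" for i j
  define A where "A = mat N N (\<lambda>(i, j). (1 + h i j) / 2)"
  define B where "B = transpose_mat A * A"
  have A: "A \<in> carrier_mat N N" unfolding A_def by simp
  then have B: "B \<in> carrier_mat N N" unfolding B_def by simp
  have symB: "transpose_mat B = B"
    using transpose_mult[of "transpose_mat A" N N A N] A unfolding B_def by simp
  have col: "(\<Sum>i<N. h i j) = c" if "j < N" for j
    using row[OF that] sym that by (metis (no_types, lifting) lessThan_iff sum.cong)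
  have gsym: "g i j = g j i" if "i < N" "j < N" for i j
    unfolding g_def using sym that by (auto intro!: sum.cong)
  have gdiag: "g i i = N" if "i < N" for i
  proof -
    have "g i i = (\<Sum>k<N. 1)"
      unfolding g_def using sym sign that by (intro sum.cong) (auto simp: power2_eq_square)
    then show ?thesis by simp
  qed
  have grow: "(\<Sum>j<N. g i j) = c\<^sup>2" if "i < N" for i
  proof -
    have "(\<Sum>j<N. g i j) = (\<Sum>k<N. h i k * (\<Sum>j<N. h k j))"
      unfolding g_def sum_distrib_left by (rule sum.swap)
    also have "\<dots> = (\<Sum>k<N. h i k) * c"
      unfolding sum_distrib_right using row by (intro sum.cong) auto
    finally show ?thesis using row[OF that] by (simp add: power2_eq_square)
  qed
  have gg: "(\<Sum>k<N. g i k * g k j) = c\<^sup>2 * g i j" if "i < N" "j < N" for i j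
  proof -
    have "(\<Sum>k<N. g i k * g k j) = (\<Sum>k<N. \<Sum>l<N. g i k * h k l * h l j)"
      by (subst (2) g_def) (simp add: sum_distrib_left mult.assoc)
    also have "\<dots> = (\<Sum>l<N. (\<Sum>k<N. g i k * h k l) * h l j)"
      unfolding sum_distrib_right by (rule sum.swap)
    also have "\<dots> = (\<Sum>l<N. c\<^sup>2 * h i l * h l j)"
      using cube[OF that(1)] unfolding g_def by (intro sum.cong) auto
    also have "\<dots> = c\<^sup>2 * g i j"
      unfolding g_def by (simp add: sum_distrib_left mult.assoc)
    finally show ?thesis .
  qed
  have entry: "B $$ (i, j) = (N + 2 * c + g i j) / 4" if "i < N" "j < N" for i j
  proof -
    have "B $$ (i, j) = (\<Sum>k<N. (1 + h k i) / 2 * ((1 + h k j) / 2))"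
      using that unfolding B_def A_def by (auto simp: scalar_prod_def lessThan_atLeast0 intro!: sum.cong)
    also have "\<dots> = (\<Sum>k<N. (1 + h k i + h k j + h i k * h k j) / 4)"
      using sym that by (intro sum.cong) (auto simp: field_simps)
    also have "\<dots> = (N + (\<Sum>k<N. h k i) + (\<Sum>k<N. h k j) + g i j) / 4"
      unfolding g_def by (simp add: sum_divide_distrib[symmetric] sum.distrib)
    finally show ?thesis using col that by simp
  qed
  obtain es where es: "proots (char_poly B) = mset es" "length es = N"
    and tr: "sum_list es = (\<Sum>i<N. B $$ (i, i))"
    and tr2: "(\<Sum>e\<leftarrow>es. e\<^sup>2) = (\<Sum>i<N. \<Sum>j<N. (B $$ (i, j))\<^sup>2)"
    and ev: "\<And>e. e \<in> set es \<Longrightarrow>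
      \<exists>v. (\<exists>i<N. v i \<noteq> 0) \<and> (\<forall>i<N. (\<Sum>j<N. B $$ (i, j) * v j) = e * v i)"
    by (rule symmetric_spectrum[OF B symB]) (rule that, assumption+, blast)
  let ?M = "((1 + s) * c / 2)\<^sup>2" and ?m = "(c / 2)\<^sup>2"
  have "e \<in> {?M, ?m, 0}" if e: "e \<in> set es" for e
  proof -
    obtain v i where i: "i < N" "v i \<noteq> 0"
      and v: "\<And>i. i < N \<Longrightarrow> (\<Sum>j<N. B $$ (i, j) * v j) = e * v i"
      using ev[OF e] by blast
    define w where "w = (\<Sum>j<N. v j)"
    have v': "(N + 2 * c) * w + (\<Sum>j<N. g i j * v j) = 4 * e * v i" if "i < N" for i
    proof -
      have "4 * e * v i = 4 * (\<Sum>j<N. B $$ (i, j) * v j)" using v[OF that] by simp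
      also have "\<dots> = (\<Sum>j<N. (N + 2 * c) * v j + g i j * v j)"
        unfolding sum_distrib_left using entry that by (intro sum.cong) (auto simp: field_simps)
      finally show ?thesis by (simp add: w_def sum.distrib sum_distrib_left)
    qed
    show ?thesis
    proof (cases "w = 0")
      case False
      have "4 * e * w = (\<Sum>i<N. (N + 2 * c) * w + (\<Sum>j<N. g i j * v j))"
        unfolding w_def sum_distrib_left using v' by (intro sum.cong) (auto simp: w_def sum_distrib_left)
      also have "\<dots> = N * (N + 2 * c) * w + (\<Sum>i<N. \<Sum>j<N. g i j * v j)"
        by (simp add: sum.distrib)
      also have "(\<Sum>i<N. \<Sum>j<N. g i j * v j) = (\<Sum>j<N. (\<Sum>i<N. g j i) * v j)"
        unfolding sum_distrib_right by (subst sum.swap) (auto intro!: sum.cong simp: gsym)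
      also have "\<dots> = c\<^sup>2 * w"
        unfolding w_def sum_distrib_left using grow by (intro sum.cong) auto
      finally have "(4 * e - (N + c)\<^sup>2) * w = 0"
        by (simp add: algebra_simps power2_eq_square)
      then have "4 * e = (N + c)\<^sup>2" using False by simp
      then have "e = ?M" unfolding N by (simp add: power2_eq_square field_simps)
      then show ?thesis by simp
    next
      case True
      then have gv: "(\<Sum>j<N. g i j * v j) = 4 * e * v i" if "i < N" for i
        using v'[OF that] by simp
      have "(\<Sum>k<N. g i k * (\<Sum>j<N. g k j * v j)) = (\<Sum>k<N. 4 * e * (g i k * v k))"
        using gv by (intro sum.cong) auto
      also have "\<dots> = 16 * e\<^sup>2 * v i"
        using gv[OF i(1)] by (simp add: sum_distrib_left[symmetric] power2_eq_square)
      finally have "16 * e\<^sup>2 * v i = (\<Sum>k<N. \<Sum>j<N. g i k * g k j * v j)"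
        by (simp add: sum_distrib_left mult.assoc)
      also have "\<dots> = (\<Sum>j<N. (\<Sum>k<N. g i k * g k j) * v j)"
        unfolding sum_distrib_right by (rule sum.swap)
      also have "\<dots> = (\<Sum>j<N. c\<^sup>2 * (g i j * v j))"
        using gg[OF i(1)] by (intro sum.cong) auto
      also have "\<dots> = c\<^sup>2 * (4 * e * v i)"
        using gv[OF i(1)] by (simp add: sum_distrib_left[symmetric])
      finally have "16 * e\<^sup>2 = 4 * c\<^sup>2 * e" using i(2) by simp
      then show ?thesis by (auto simp: power2_eq_square)
    qed
  qed
  then have sub: "set_mset (mset es) \<subseteq> {?M, ?m, 0}" by auto
  have ne: "?M \<noteq> ?m" "?M \<noteq> 0" "?m \<noteq> 0"
  proof -
    have "c / 2 < (1 + s) * c / 2" using c s by simp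
    then have "?m < ?M" using c by (intro power_strict_mono) auto
    then show "?M \<noteq> ?m" by simp
  qed (use c in \<open>auto simp: add_nonneg_eq_0_iff\<close>)
  \<comment> \<open>\<open>x = 1\<close> and \<open>y = s\<^sup>2 - 1\<close> will follow from the equations \<open>e1\<close> and \<open>e2\<close>, the two traces
    divided by powers of \<open>c / 2\<close>.\<close>
  define x y z where "x = count (mset es) ?M" and "y = count (mset es) ?m" and "z = count (mset es) 0"
  have S: "mset es = replicate_mset x ?M + replicate_mset y ?m + replicate_mset z 0"
    unfolding x_def y_def z_def by (rule mset_three_values[OF sub ne])
  have "sum_list es = x * ?M + y * ?m"
    unfolding sum_mset_sum_list[symmetric] S by simp
  moreover have "sum_list es = (\<Sum>i<N. (N + 2 * c + N) / 4)"
    unfolding tr using entry gdiag by (intro sum.cong) auto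
  ultimately have "x * ?M + y * ?m = N * (N + c) / 2"
    by (simp add: field_simps)
  then have "c\<^sup>2 * (x * (1 + s)\<^sup>2 + y) = c\<^sup>2 * (2 * s * (s + 1))"
    unfolding N by (simp add: power2_eq_square field_simps)
  then have e1: "x * (1 + real s)\<^sup>2 + y = 2 * s * (s + 1)"
    using c by simp
  have "(\<Sum>e\<leftarrow>es. e\<^sup>2) = x * ?M\<^sup>2 + y * ?m\<^sup>2"
  proof -
    have "(\<Sum>e\<leftarrow>es. e\<^sup>2) = sum_mset (image_mset (\<lambda>e. e\<^sup>2) (mset es))"
      by (metis mset_map sum_mset_sum_list)
    then show ?thesis unfolding S by simp
  qed
  moreover have "(\<Sum>e\<leftarrow>es. e\<^sup>2) = (\<Sum>i<N. ((N + 2 * c)\<^sup>2 * N + 2 * (N + 2 * c) * c\<^sup>2 + c\<^sup>2 * N) / 16)"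
    unfolding tr2
  proof (intro sum.cong refl)
    fix i assume "i \<in> {..<N}"
    then have i: "i < N" by simp
    have "(\<Sum>j<N. (B $$ (i, j))\<^sup>2)
      = (\<Sum>j<N. ((N + 2 * c)\<^sup>2 + 2 * (N + 2 * c) * g i j + g i j * g j i) / 16)"
    proof (intro sum.cong refl)
      fix j assume "j \<in> {..<N}"
      then have j: "j < N" by simp
      show "(B $$ (i, j))\<^sup>2 = ((N + 2 * c)\<^sup>2 + 2 * (N + 2 * c) * g i j + g i j * g j i) / 16"
        unfolding entry[OF i j] gsym[OF j i] by (simp add: power2_eq_square field_simps)
    qed
    also have "\<dots> = ((N + 2 * c)\<^sup>2 * N + 2 * (N + 2 * c) * (\<Sum>j<N. g i j)
        + (\<Sum>j<N. g i j * g j i)) / 16"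
      by (simp add: sum_divide_distrib[symmetric] sum.distrib sum_distrib_left)
    finally show "(\<Sum>j<N. (B $$ (i, j))\<^sup>2)
      = ((N + 2 * c)\<^sup>2 * N + 2 * (N + 2 * c) * c\<^sup>2 + c\<^sup>2 * N) / 16"
      using grow[OF i] gg[OF i i] gdiag[OF i] by simp
  qed
  ultimately have "16 * (x * ?M\<^sup>2 + y * ?m\<^sup>2)
      = N * ((N + 2 * c)\<^sup>2 * N + 2 * (N + 2 * c) * c\<^sup>2 + c\<^sup>2 * N)"
    by simp
  moreover have "16 * (x * ?M\<^sup>2 + y * ?m\<^sup>2) = c ^ 4 * (x * (1 + real s) ^ 4 + y)"
  proof -
    have fourth: "?M\<^sup>2 = c ^ 4 * (1 + real s) ^ 4 / 16" "?m\<^sup>2 = c ^ 4 / 16"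
      by (simp_all add: power_divide power_mult_distrib flip: power_mult)
    show ?thesis unfolding fourth by (simp add: distrib_left)
  qed
  moreover have "real N * ((N + 2 * c)\<^sup>2 * N + 2 * (N + 2 * c) * c\<^sup>2 + c\<^sup>2 * N)
      = c ^ 4 * ((1 + real s) ^ 4 + (real s)\<^sup>2 - 1)"
    unfolding N by (simp add: power2_eq_square power4_eq_xxxx algebra_simps)
  ultimately have e2: "x * (1 + real s) ^ 4 + y = (1 + real s) ^ 4 + (real s)\<^sup>2 - 1"
    using c by simp
  have "(real x - 1) * ((1 + real s) ^ 4 - (1 + real s)\<^sup>2) = 0"
    using e1 e2 by (simp add: algebra_simps power2_eq_square)
  moreover have "(1 + real s)\<^sup>2 < (1 + real s) ^ 4"
    using s by (intro power_strict_increasing) auto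
  ultimately have x: "x = 1" by simp
  have "real y = (real s)\<^sup>2 - 1"
    using e1 unfolding x by (simp add: algebra_simps power2_eq_square)
  then have "real (y + 1) = real (s\<^sup>2)" by simp
  then have ys: "y + 1 = s\<^sup>2" unfolding of_nat_eq_iff .
  have "size (mset es) = x + y + z" unfolding S by simp
  then have z: "z = N - s\<^sup>2" using x ys es(2) by simp
  have y: "y = s\<^sup>2 - 1" using ys by simp
  show ?thesis
    using c unfolding A_def[symmetric] singular_values_def B_def[symmetric] es(1) S x y z
    by (simp add: real_sqrt_abs real_sqrt_mult)
qed

lemma sum_largest_lambda_star:
  assumes "singular_values (adjacency_mat G) = mset xs" "sorted (rev xs)" "k \<le> length xs"
  shows "(\<Sum>i = 1..k. lambda_star G i) = sum_list (take k xs)"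
proof -
  have "sort xs = rev xs" using assms(2) by (intro properties_for_sort) auto
  then have "lambda_star G i = (if 1 \<le> i \<and> i \<le> length xs then xs ! (i - 1) else 0)" for i
    unfolding lambda_star_def assms(1) by simp
  then have "(\<Sum>i = 1..k. lambda_star G i) = (\<Sum>i<k. xs ! i)"
    unfolding One_nat_def sum.atLeast1_atMost_eq using assms(3) by (intro sum.cong) auto
  also have "\<dots> = sum_list (take k xs)"
    using assms(3) by (auto simp: sum_list_sum_nth lessThan_atLeast0)
  finally show ?thesis .
qed

section \<open>Construction of the sign matrix\<close>

text \<open>
  The columns run through all sign vectors of length \<open>s\<close>, the sign in row \<open>i\<close> being bit \<open>i\<close> of the column
  index. Flipping one bit is an involution on the columns that negates exactly one factor of the
  product of two distinct rows.
\<close>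

lemma orthogonal_sign_rows:
  "\<exists>X :: nat \<Rightarrow> nat \<Rightarrow> real. (\<forall>i a. X i a * X i a = 1) \<and>
    (\<forall>i<s. \<forall>j<s. (\<Sum>a<2 ^ s. X i a * X j a) = (if i = j then 2 ^ s else 0))"
proof -
  define X :: "nat \<Rightarrow> nat \<Rightarrow> real" where "X i a = (if bit a i then 1 else - 1)" for i a
  have "(\<Sum>a<2 ^ s. X i a * X j a) = 0" if "i < s" "j < s" "i \<noteq> j" for i j
  proof -
    have inv: "flip_bit i (flip_bit i a) = a" for a :: nat
      by (rule bit_eqI) (auto simp: bit_flip_bit_iff)
    have bound: "flip_bit i a < 2 ^ s" if "a < 2 ^ s" for a :: nat
      using that \<open>i < s\<close>
      by (simp add: take_bit_flip_bit_eq flip: take_bit_nat_eq_self_iff)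
    have "(\<Sum>a<2 ^ s. X i a * X j a) = (\<Sum>a<2 ^ s. - (X i a * X j a))"
      by (rule sum.reindex_bij_witness[of _ "flip_bit i" "flip_bit i"])
        (use inv bound that(3) in \<open>auto simp: X_def bit_flip_bit_iff\<close>)
    then show ?thesis by (simp add: sum_negf)
  qed
  moreover have "X i a * X i a = 1" for i a
    unfolding X_def by simp
  ultimately show ?thesis by (intro exI[of _ X]) auto
qed

lemma sum_mod_div:
  fixes f :: "nat \<Rightarrow> nat \<Rightarrow> 'a :: comm_monoid_add"
  shows "(\<Sum>i<q * k. f (i mod k) (i div k)) = (\<Sum>d<q. \<Sum>r<k. f r d)"
proof -
  have "(\<Sum>i = d * k..<d * k + k. f (i mod k) (i div k)) = (\<Sum>r<k. f r d)" for d
  proof -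
    have "(\<Sum>i = d * k..<d * k + k. f (i mod k) (i div k))
        = (\<Sum>r = 0..<k. f ((r + d * k) mod k) ((r + d * k) div k))"
      using sum.shift_bounds_nat_ivl[of "\<lambda>i. f (i mod k) (i div k)" 0 "d * k" k]
      by (simp add: add.commute)
    then show ?thesis by (simp add: lessThan_atLeast0)
  qed
  then show ?thesis by (simp flip: sum.nat_group)
qed

text \<open>
  The index \<open>i < s * n * t\<close> encodes the row \<open>i mod s\<close>, the column \<open>i div s mod n\<close> and one of \<open>t\<close> copies of
  that position, as in a blow-up by constant \<open>t \<times> t\<close> blocks.
\<close>

lemma sum_blow_up:
  fixes F :: "nat \<Rightarrow> nat \<Rightarrow> real"
  shows "(\<Sum>i<s * n * t. F (i mod s) (i div s mod n)) = t * (\<Sum>r<s. \<Sum>a<n. F r a)"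
proof -
  have "(\<Sum>i<s * n * t. F (i mod s) (i div s mod n)) = (\<Sum>d<t * n. \<Sum>r<s. F r (d mod n))"
    using sum_mod_div[where f = "\<lambda>r d. F r (d mod n)" and q = "t * n" and k = s] by (simp add: mult_ac)
  also have "\<dots> = t * (\<Sum>a<n. \<Sum>r<s. F r a)"
    using sum_mod_div[where f = "\<lambda>a _. \<Sum>r<s. F r a" and q = t and k = n] by simp
  finally show ?thesis by (subst sum.swap)
qed

text \<open>
  The matrix is \<open>- D M D\<close>, blown up, with \<open>M\<close> and \<open>Y\<close> as in the introduction and \<open>D\<close> the diagonal matrix
  of the entries of \<open>Y\<close>. Since \<open>D\<^sup>2\<close> is the identity, the signs in \<open>D\<close> cancel in products, and both the
  row sums and the cube reduce to the orthogonality of the rows of \<open>X\<close>.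
\<close>

lemma sign_matrix_exists:
  fixes s t :: nat
  assumes "even s" "s > 0"
  shows "\<exists>h :: nat \<Rightarrow> nat \<Rightarrow> real.
    (\<forall>i j. (h i j)\<^sup>2 = 1) \<and> (\<forall>i j. h i j = h j i) \<and> (\<forall>i. h i i = - 1) \<and>
    (\<forall>i. (\<Sum>j<s * 2 ^ s * t. h i j) = 2 ^ s * real t) \<and>
    (\<forall>i j. (\<Sum>k<s * 2 ^ s * t. (\<Sum>l<s * 2 ^ s * t. h i l * h l k) * h k j)
      = (2 ^ s * real t)\<^sup>2 * h i j)"
proof -
  define n :: nat where "n = 2 ^ s"
  obtain X :: "nat \<Rightarrow> nat \<Rightarrow> real" where X': "\<forall>i a. X i a * X i a = 1"
    and orth': "\<forall>i<s. \<forall>j<s. (\<Sum>a<2 ^ s. X i a * X j a) = (if i = j then 2 ^ s else 0)"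
    using orthogonal_sign_rows[of s] by blast
  have X: "X i a * X i a = 1" for i a
    using X' by simp
  have orth: "(\<Sum>a<n. X i a * X j a) = (if i = j then n else 0)" if "i < s" "j < s" for i j
    using orth' that unfolding n_def by simp
  \<comment> \<open>\<open>Y = Q X\<close> for the skew-symmetric signed permutation matrix with \<open>Q(r, \<pi> r) = \<epsilon> r\<close>\<close>
  define \<pi> :: "nat \<Rightarrow> nat" where "\<pi> r = (if even r then r + 1 else r - 1)" for r
  define \<epsilon> :: "nat \<Rightarrow> real" where "\<epsilon> r = (if even r then 1 else - 1)" for r
  define Y where "Y r a = \<epsilon> r * X (\<pi> r) a" for r a
  have \<pi>_less: "\<pi> r < s" if "r < s" for r
    using that \<open>even s\<close> unfolding \<pi>_def by (auto elim!: evenE simp: less_Suc_eq)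
  have \<pi>_inv: "\<pi> (\<pi> r) = r" for r
    unfolding \<pi>_def by auto
  have \<epsilon>_\<pi>: "\<epsilon> (\<pi> r) = - \<epsilon> r" for r
    unfolding \<pi>_def \<epsilon>_def by auto
  have Y: "Y r a * Y r a = 1" for r a
    using X[of "\<pi> r" a] unfolding Y_def \<epsilon>_def by auto
  \<comment> \<open>the eigenvector equation \<open>M Y = - n Y\<close>\<close>
  have XY: "(\<Sum>r'<s. \<Sum>a<n. X r a * X r' b * Y r' a) = - (n * Y r b)" if r: "r < s" for r b
  proof -
    have "(\<Sum>r'<s. \<Sum>a<n. X r a * X r' b * Y r' a)
        = (\<Sum>r'<s. X r' b * \<epsilon> r' * (\<Sum>a<n. X r a * X (\<pi> r') a))"
      unfolding Y_def sum_distrib_left by (intro sum.cong) (auto simp: mult_ac)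
    also have "\<dots> = (\<Sum>r'<s. if r' = \<pi> r then n * (X r' b * \<epsilon> r') else 0)"
      using orth[OF r] \<pi>_less \<pi>_inv by (intro sum.cong) auto
    also have "\<dots> = - (n * Y r b)"
      using \<pi>_less[OF r] by (simp add: \<epsilon>_\<pi> Y_def)
    finally show ?thesis .
  qed
  define p q where "p i = i mod s" and "q i = i div s mod n" for i
  define y where "y i = Y (p i) (q i)" for i
  define h where "h i j = - (y i * X (p i) (q j) * X (p j) (q i) * y j)" for i j
  have p: "p i < s" for i unfolding p_def using \<open>s > 0\<close> by simp
  have y: "y i * y i = 1" for i unfolding y_def by (rule Y)
  have blow_up: "(\<Sum>i<s * n * t. F (p i) (q i)) = t * (\<Sum>r<s. \<Sum>a<n. F r a)"
    for F :: "nat \<Rightarrow> nat \<Rightarrow> real"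
    unfolding p_def q_def by (rule sum_blow_up)
  have "(h i j)\<^sup>2 = (y i * y i) * (X (p i) (q j) * X (p i) (q j))
      * (X (p j) (q i) * X (p j) (q i)) * (y j * y j)" for i j
    unfolding h_def power2_eq_square by (simp add: mult_ac)
  then have sq: "(h i j)\<^sup>2 = 1" for i j by (simp add: X y)
  have sym: "h i j = h j i" for i j unfolding h_def by (simp add: mult_ac)
  have "h i i = - ((y i * y i) * (X (p i) (q i) * X (p i) (q i)))" for i
    unfolding h_def by (simp add: mult_ac)
  then have diag: "h i i = - 1" for i by (simp add: X y)
  have row: "(\<Sum>j<s * n * t. h i j) = n * t" for i
  proof -
    have "(\<Sum>j<s * n * t. h i j)
        = - y i * (\<Sum>j<s * n * t. X (p i) (q j) * X (p j) (q i) * Y (p j) (q j))"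
      unfolding h_def y_def[of j for j] sum_distrib_left by (simp add: mult_ac)
    also have "\<dots> = t * n * (y i * y i)"
      unfolding blow_up[of "\<lambda>r a. X (p i) a * X r (q i) * Y r a"] XY[OF p] y_def by simp
    finally show ?thesis by (simp add: y)
  qed
  define K where "K i k = (if p i = p k then \<Sum>r<s. X r (q i) * X r (q k) else 0)" for i k
  \<comment> \<open>The sum over the columns of two rows of \<open>X\<close> leaves only pairs of positions in the same row
    of \<open>X\<close>, and on these \<open>K\<close> is the inner product of the two columns.\<close>
  have square: "(\<Sum>l<s * n * t. h i l * h l k)
      = n * t * (y i * y k * K i k)" for i k
  proof -
    have "h i l * h l k = y i * y k * (X (p l) (q i) * X (p l) (q k) * (X (p i) (q l) * X (p k) (q l)))
        * (y l * y l)" for l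
      unfolding h_def by (simp add: mult_ac)
    then have "(\<Sum>l<s * n * t. h i l * h l k) = y i * y k *
        (\<Sum>l<s * n * t. X (p l) (q i) * X (p l) (q k) * (X (p i) (q l) * X (p k) (q l)))"
      unfolding sum_distrib_left by (simp add: y)
    also have "\<dots> = y i * y k * (t * (\<Sum>r<s. X r (q i) * X r (q k) *
        (\<Sum>a<n. X (p i) a * X (p k) a)))"
      unfolding blow_up[of "\<lambda>r a. X r (q i) * X r (q k) * (X (p i) a * X (p k) a)"]
      by (simp add: sum_distrib_left)
    finally show ?thesis
      unfolding orth[OF p p] K_def by (simp add: sum_distrib_left mult_ac)
  qed
  have cube: "(\<Sum>k<s * n * t. (\<Sum>l<s * n * t. h i l * h l k) * h k j) = (n * t)\<^sup>2 * h i j" for i j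
  proof -
    have "(\<Sum>l<s * n * t. h i l * h l k) * h k j = - (n * t * y i * y j) *
        (K i k
          * X (p k) (q j) * X (p j) (q k)) * (y k * y k)" for k
      unfolding square unfolding h_def by (simp add: mult_ac)
    then have "(\<Sum>k<s * n * t. (\<Sum>l<s * n * t. h i l * h l k) * h k j) = - (n * t * y i * y j) *
        (\<Sum>k<s * n * t. K i k
          * X (p k) (q j) * X (p j) (q k))"
      unfolding sum_distrib_left by (simp add: y)
    also have "\<dots> = - (n * t * y i * y j) * (t * (\<Sum>r'<s. if p i = r' then
        (\<Sum>a<n. (\<Sum>r<s. X r (q i) * X r a) * X r' (q j) * X (p j) a) else 0))"
      unfolding K_def blow_up[of "\<lambda>r' a. (if p i = r' then \<Sum>r<s. X r (q i) * X r a else 0)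
          * X r' (q j) * X (p j) a"]
      by (intro arg_cong2[of _ _ _ _ "(*)"] refl sum.cong) auto
    also have "\<dots> = - (n * t * y i * y j) * (t *
        (\<Sum>a<n. (\<Sum>r<s. X r (q i) * X r a) * X (p i) (q j) * X (p j) a))"
      using p by simp
    also have "(\<Sum>a<n. (\<Sum>r<s. X r (q i) * X r a) * X (p i) (q j) * X (p j) a)
        = (\<Sum>r<s. X r (q i) * X (p i) (q j) * (\<Sum>a<n. X r a * X (p j) a))"
      unfolding sum_distrib_left sum_distrib_right
      by (subst sum.swap) (simp add: mult_ac)
    also have "\<dots> = (\<Sum>r<s. if r = p j then n * (X r (q i) * X (p i) (q j)) else 0)"
      using orth p by (intro sum.cong) auto
    also have "\<dots> = n * (X (p j) (q i) * X (p i) (q j))"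
      using p by simp
    finally show ?thesis unfolding h_def by (simp add: power2_eq_square mult_ac)
  qed
  show ?thesis
    by (intro exI[of _ h] conjI allI)
      (use sq sym diag row cube in \<open>simp_all add: n_def\<close>)
qed

section \<open>The graphs\<close>

theorem theorem4p4:
  fixes s :: nat
  assumes "even s" and "s > 0"
  shows "\<exists>n::nat. n > 0 \<and> (\<forall>t::nat. t > 0 \<longrightarrow>
    (\<exists>G :: nat pair_pre_digraph. pair_graph G \<and> card (pverts G) = s * n * t \<and>
      (\<Sum>i = 1..s\<^sup>2. lambda_star G i) = 1 / 2 * (1 + real s) * real (s * n * t)))"
proof (intro exI[of _ "2 ^ s"] conjI allI impI)
  fix t :: nat assume t: "t > 0"
  define N c where "N = s * 2 ^ s * t" and "c = 2 ^ s * real t"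
  obtain h :: "nat \<Rightarrow> nat \<Rightarrow> real" where h: "\<forall>i j. (h i j)\<^sup>2 = 1" "\<forall>i j. h i j = h j i"
      "\<forall>i. h i i = - 1" "\<forall>i. (\<Sum>j<N. h i j) = c"
      "\<forall>i j. (\<Sum>k<N. (\<Sum>l<N. h i l * h l k) * h k j) = c\<^sup>2 * h i j"
    using sign_matrix_exists[OF assms, of t] unfolding N_def c_def by blast
  define G where "G = \<lparr>pverts = {..<N}, parcs = {(i, j). i < N \<and> j < N \<and> h i j = 1}\<rparr>"
  have "finite (parcs G)"
    by (rule finite_subset[of _ "{..<N} \<times> {..<N}"]) (auto simp: G_def)
  then have G: "pair_graph G"
    using h(2,3) by unfold_locales (auto simp: G_def symmetric_def intro!: symI)
  have "(if h i j = 1 then 1 else 0) = (1 + h i j) / 2" for i j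
    using h(1)[rule_format, of i j] by (auto simp: power2_eq_1_iff)
  then have "adjacency_mat G = mat N N (\<lambda>(i, j). (1 + h i j) / 2)"
    unfolding adjacency_mat_def G_def
    by (intro eq_matI) (simp_all add: lessThan_atLeast0 Let_def)
  moreover have "c > 0" "real N = s * c" using t by (simp_all add: c_def N_def)
  ultimately have "singular_values (adjacency_mat G) =
      add_mset ((1 + s) * c / 2) (replicate_mset (s\<^sup>2 - 1) (c / 2) + replicate_mset (N - s\<^sup>2) 0)"
    using sign_matrix_singular_values[of c s N h] h(1,2,4,5) \<open>s > 0\<close> by simp
  also have "\<dots> = mset ((1 + s) * c / 2 # replicate (s\<^sup>2 - 1) (c / 2) @ replicate (N - s\<^sup>2) 0)"
    by simp
  finally have sv: "singular_values (adjacency_mat G) =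
    mset ((1 + s) * c / 2 # replicate (s\<^sup>2 - 1) (c / 2) @ replicate (N - s\<^sup>2) 0)" (is "_ = mset ?xs") .
  \<comment> \<open>There are at least \<open>s\<^sup>2\<close> vertices, so no summand falls outside the list of singular values.\<close>
  have "s * s \<le> s * (2 ^ s * t)"
    using less_exp[of s] t by (intro mult_left_mono) (auto intro: order.trans[of _ "2 ^ s"])
  then have sN: "s\<^sup>2 \<le> N" unfolding N_def by (simp add: power2_eq_square mult_ac)
  have s2: "s\<^sup>2 \<ge> 1" using \<open>s > 0\<close> by simp
  have "sorted (rev ?xs)"
    using \<open>c > 0\<close> by (auto simp: sorted_append sorted_replicate)
  then have "(\<Sum>i = 1..s\<^sup>2. lambda_star G i) = sum_list (take (s\<^sup>2) ?xs)"
    using sv sN s2 by (intro sum_largest_lambda_star) auto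
  also have "take (s\<^sup>2) ?xs = (1 + s) * c / 2 # replicate (s\<^sup>2 - 1) (c / 2)"
    using s2 by (cases "s\<^sup>2") auto
  also have "sum_list \<dots> = (1 + s) * c / 2 + (real (s\<^sup>2) - 1) * (c / 2)"
    using s2 by (simp add: sum_list_replicate of_nat_diff)
  also have "\<dots> = 1 / 2 * (1 + real s) * real N"
    unfolding \<open>real N = s * c\<close> by (simp add: power2_eq_square field_simps)
  finally show "\<exists>G :: nat pair_pre_digraph. pair_graph G \<and> card (pverts G) = s * 2 ^ s * t \<and>
      (\<Sum>i = 1..s\<^sup>2. lambda_star G i) = 1 / 2 * (1 + real s) * real (s * 2 ^ s * t)"
    using G by (intro exI[of _ G]) (simp add: G_def N_def)
qed simp

end
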